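(* Let $(C,\le)$ be a causal set, let $n\ge2$, let $\gamma=(x_0,\dots,x_{n+2})$ be a maximising geodesic in $C$, and set $x:=x_0$, $y:=x_n$, $N_x^{(2)}:=|J(x,x_2)|$, $N_y^{(2)}:=|J(y,x_{n+2})|$. Then for every $\alpha\in[0,1]$ $$\kappa_2(\gamma)=0\qquad\text{and}\qquad \kappa_2^\alpha(\gamma)=(1-\alpha)\,\kappa_2^{\mathrm{LLY}}(\gamma)=\frac{1-\alpha}{n}\left(\frac1{N_y^{(2)}-1}-\frac1{N_x^{(2)}-1}\right).$$
   Context: A causal set is a pair $(C,\le)$ where $\le$ is a partial order on the set $C$ such that every causal diamond $J(x,z)=\{y\in C:x\le y\le z\}$ is finite. Write $x\ll y$ if $x\le y$ and $x\ne y$. The time separation is $\tau(x,y)=\max\{m: x=z_0\ll z_1\ll\dots\ll z_m=y\}$ if $x\le y$, and $\tau(x,y)=0$ otherwise. A chain $x_0\ll\dots\ll x_m$ is a (maximising) geodesic if $m=\tau(x_0,x_m)$. For finitely supported probability measures $\mu,\nu$ on $C$, $\ell_1(\mu,\nu)=\max_\pi\sum_{a,b}\pi(a,b)\tau(a,b)$ over couplings $\pi$ of $\mu,\nu$ with $\pi(a,b)=0$ whenever $a\not\le b$ ($-\infty$ if none exist). For integers $n\ge r\ge1$, a maximising geodesic $\gamma=(x_0,\dots,x_{n+r})$, and $\alpha\in[0,1]$, put $x=x_0$, $y=x_n$, $N_x=|J(x,x_r)|$, $N_y=|J(y,x_{n+r})|$; $\mu_x$ is the uniform probability measure on $J(x,x_r)$,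 $\mu_y$ the uniform probability measure on $J(y,x_{n+r})$, and $$\mu_x^\alpha=\alpha\delta_x+\frac{1-\alpha}{N_x-1}\sum_{z\in J(x,x_r)\setminus\{x\}}\delta_z,\qquad \mu_y^\alpha=\alpha\delta_y+\frac{1-\alpha}{N_y-1}\sum_{z\in J(y,x_{n+r})\setminus\{y\}}\delta_z.$$ Then $\kappa_r(\gamma)=\frac{\ell_1(\mu_x,\mu_y)}{\tau(x,y)}-1$, $\kappa_r^\alpha(\gamma)=\frac{\ell_1(\mu_x^\alpha,\mu_y^\alpha)}{\tau(x,y)}-1$, $\kappa_r^{\mathrm{LLY}}(\gamma)=\lim_{\alpha\to1}\frac{\kappa_r^\alpha(\gamma)}{1-\alpha}$. The statement concerns $r=2$. *)

theory Defs
  imports "HOL-Probability.Probability"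
begin

text \<open>The order on the carrier \<open>C\<close> is a relation \<open>R \<subseteq> C \<times> C\<close>: \<open>x \<le> y\<close> is \<open>(x, y) \<in> R\<close>. The inclusion is part
  of \<^const>\<open>partial_order_on\<close>, so the diamonds below automatically lie in \<open>C\<close>.\<close>

definition diamond :: "('a \<times> 'a) set \<Rightarrow> 'a \<Rightarrow> 'a \<Rightarrow> 'a set" where
  "diamond R x z = {y. (x, y) \<in> R \<and> (y, z) \<in> R}"

definition causal_set :: "'a set \<Rightarrow> ('a \<times> 'a) set \<Rightarrow> bool" where
  "causal_set C R \<longleftrightarrow> partial_order_on C R \<and> (\<forall>x\<in>C. \<forall>z\<in>C. finite (diamond R x z))"

definition chron :: "('a \<times> 'a) set \<Rightarrow> 'a \<Rightarrow> 'a \<Rightarrow> bool" where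
  "chron R x y \<longleftrightarrow> (x, y) \<in> R \<and> x \<noteq> y"

text \<open>The set under \<^const>\<open>Max\<close> is finite in a causal set (a chain from \<open>x\<close> to \<open>y\<close> stays in the diamond) and
  nonempty whenever \<open>x \<le> y\<close>.\<close>

definition time_sep :: "('a \<times> 'a) set \<Rightarrow> 'a \<Rightarrow> 'a \<Rightarrow> nat" where
  "time_sep R x y =
     (if (x, y) \<in> R
      then Max {m. \<exists>z :: nat \<Rightarrow> 'a. z 0 = x \<and> z m = y \<and> (\<forall>i<m. chron R (z i) (z (Suc i)))}
      else 0)"

text \<open>A tuple \<open>(x\<^sub>0, \<dots>, x\<^sub>m)\<close> is a function on \<^typ>\<open>nat\<close> of which only the values at \<open>0, \<dots>, m\<close> matter.\<close>

definition max_geodesic :: "'a set \<Rightarrow> ('a \<times> 'a) set \<Rightarrow> nat \<Rightarrow> (nat \<Rightarrow> 'a) \<Rightarrow> bool" where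
  "max_geodesic C R m \<gamma> \<longleftrightarrow>
     (\<forall>i\<le>m. \<gamma> i \<in> C) \<and> (\<forall>i<m. chron R (\<gamma> i) (\<gamma> (Suc i))) \<and> m = time_sep R (\<gamma> 0) (\<gamma> m)"

definition causal_couplings :: "('a \<times> 'a) set \<Rightarrow> 'a pmf \<Rightarrow> 'a pmf \<Rightarrow> ('a \<times> 'a) pmf set" where
  "causal_couplings R \<mu> \<nu> =
     {\<pi>. map_pmf fst \<pi> = \<mu> \<and> map_pmf snd \<pi> = \<nu> \<and> (\<forall>a b. (a, b) \<notin> R \<longrightarrow> pmf \<pi> (a, b) = 0)}"

definition transport_value :: "('a \<times> 'a) set \<Rightarrow> ('a \<times> 'a) pmf \<Rightarrow> real" where
  "transport_value R \<pi> = (\<Sum>(a, b)\<in>set_pmf \<pi>. pmf \<pi> (a, b) * real (time_sep R a b))"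

text \<open>Only used for \<open>\<mu>\<close> and \<open>\<nu>\<close> of finite support; then couplings have finite support too, so the sum above
  is a genuine finite sum. \<^const>\<open>Greatest\<close> is the attained maximum (\<^const>\<open>Max\<close> would require a finite set of
  values).\<close>

definition ell_1 :: "('a \<times> 'a) set \<Rightarrow> 'a pmf \<Rightarrow> 'a pmf \<Rightarrow> ereal" where
  "ell_1 R \<mu> \<nu> =
     (if causal_couplings R \<mu> \<nu> = {} then -\<infinity>
      else ereal (GREATEST v. v \<in> transport_value R ` causal_couplings R \<mu> \<nu>))"

definition unif_diamond :: "('a \<times> 'a) set \<Rightarrow> 'a \<Rightarrow> 'a \<Rightarrow> 'a pmf" where
  "unif_diamond R x z = pmf_of_set (diamond R x z)"

text \<open>The mass function below is a probability mass function for \<open>0 \<le> \<alpha> \<le> 1\<close> and a diamond with at least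
  two points; see \<open>pmf_lazy_diamond\<close>.\<close>

definition lazy_diamond :: "('a \<times> 'a) set \<Rightarrow> real \<Rightarrow> 'a \<Rightarrow> 'a \<Rightarrow> 'a pmf" where
  "lazy_diamond R \<alpha> x z =
     embed_pmf (\<lambda>w. \<alpha> * indicator {x} w
       + (1 - \<alpha>) / (real (card (diamond R x z)) - 1)
           * (\<Sum>u\<in>diamond R x z - {x}. indicator {u} w))"

lemma pmf_lazy_diamond:
  assumes "causal_set C R" and xz: "chron R x z" and \<alpha>: "0 \<le> \<alpha>" "\<alpha> \<le> 1"
  shows "pmf (lazy_diamond R \<alpha> x z) w =
     \<alpha> * indicator {x} w
       + (1 - \<alpha>) / (real (card (diamond R x z)) - 1)
           * (\<Sum>u\<in>diamond R x z - {x}. indicator {u} w)"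
proof -
  define J where "J = diamond R x z"
  define c where "c = (1 - \<alpha>) / (real (card J) - 1)"
  define f :: "'a \<Rightarrow> real"
    where "f = (\<lambda>w. \<alpha> * indicator {x} w + c * (\<Sum>u\<in>J - {x}. indicator {u} w))"
  have po: "partial_order_on C R" and fin: "\<And>x z. x \<in> C \<Longrightarrow> z \<in> C \<Longrightarrow> finite (diamond R x z)"
    using assms(1) by (auto simp: causal_set_def)
  have RC: "R \<subseteq> C \<times> C" and refl: "refl_on C R"
    using po by (auto simp: partial_order_on_def preorder_on_def)
  have C: "x \<in> C" "z \<in> C" using xz RC by (auto simp: chron_def)
  have J: "finite J" "x \<in> J" "z \<in> J" and ne: "x \<noteq> z"
    using xz C fin refl by (auto simp: J_def diamond_def chron_def refl_on_def)
  have "card {x, z} \<le> card J" using J by (intro card_mono) auto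
  then have card: "2 \<le> card J" using ne by simp
  then have c0: "0 \<le> c" using \<alpha> by (simp add: c_def)
  have f0: "0 \<le> f w" for w
    using c0 \<alpha> by (auto simp: f_def intro!: add_nonneg_nonneg mult_nonneg_nonneg sum_nonneg)
  have f_eq: "f w = (if w = x then \<alpha> else if w \<in> J then c else 0)" for w
    using J by (auto simp: f_def indicator_def)
  have "(\<Sum>w\<in>J. f w) = f x + (\<Sum>w\<in>J - {x}. f w)" using J by (simp add: sum.remove)
  also have "(\<Sum>w\<in>J - {x}. f w) = (\<Sum>w\<in>J - {x}. c)" by (intro sum.cong) (auto simp: f_eq)
  also have "f x + \<dots> = 1" using J card by (simp add: f_eq c_def of_nat_diff)
  finally have s: "(\<Sum>w\<in>J. f w) = 1" .
  have "(\<integral>\<^sup>+w. ennreal (f w) \<partial>count_space UNIV) = (\<Sum>w\<in>J. ennreal (f w))"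
    using J by (intro nn_integral_count_space') (auto simp: f_eq)
  also have "\<dots> = 1" using s f0 by (simp add: sum_ennreal)
  finally have "pmf (embed_pmf f) w = f w" using f0 by (intro pmf_embed_pmf) auto
  then show ?thesis by (simp add: lazy_diamond_def f_def c_def J_def)
qed

definition kappa :: "('a \<times> 'a) set \<Rightarrow> nat \<Rightarrow> nat \<Rightarrow> (nat \<Rightarrow> 'a) \<Rightarrow> ereal" where
  "kappa R r n \<gamma> =
     ell_1 R (unif_diamond R (\<gamma> 0) (\<gamma> r)) (unif_diamond R (\<gamma> n) (\<gamma> (n + r)))
       / ereal (real (time_sep R (\<gamma> 0) (\<gamma> n))) - 1"

definition kappa_alpha :: "('a \<times> 'a) set \<Rightarrow> nat \<Rightarrow> real \<Rightarrow> nat \<Rightarrow> (nat \<Rightarrow> 'a) \<Rightarrow> ereal" where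
  "kappa_alpha R r \<alpha> n \<gamma> =
     ell_1 R (lazy_diamond R \<alpha> (\<gamma> 0) (\<gamma> r)) (lazy_diamond R \<alpha> (\<gamma> n) (\<gamma> (n + r)))
       / ereal (real (time_sep R (\<gamma> 0) (\<gamma> n))) - 1"

definition kappa_LLY :: "('a \<times> 'a) set \<Rightarrow> nat \<Rightarrow> nat \<Rightarrow> (nat \<Rightarrow> 'a) \<Rightarrow> ereal" where
  "kappa_LLY R r n \<gamma> = Lim (at_left 1) (\<lambda>\<alpha>. kappa_alpha R r \<alpha> n \<gamma> / ereal (1 - \<alpha>))"

end

theory Submission
  imports Defs
begin

text \<open>Since \<open>x\<^sub>2 \<le> y\<close>, every point \<open>a\<close> of \<open>J(x, x\<^sub>2)\<close> precedes every point \<open>b\<close> of \<open>J(y, x\<^sub>n\<^sub>+\<^sub>2)\<close>. In a diamond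
  \<open>J(u, v)\<close> with \<open>\<tau>(u, v) = 2\<close> the level \<open>\<tau>(u, w)\<close> is \<open>0\<close> at \<open>u\<close>, \<open>2\<close> at \<open>v\<close> and \<open>1\<close> elsewhere, and
  \<open>\<tau>(u, w) + \<tau>(w, v) = 2\<close> for every \<open>w\<close>. Two applications of the reverse triangle inequality then give
  \<open>\<tau>(a, b) = n + \<tau>(y, b) - \<tau>(x, a)\<close>. This cost is separable, so every coupling is optimal and
  \<open>\<ell>\<^sub>1\<close> is \<open>n\<close> plus the difference of the mean levels. The mean level of a diamond with \<open>N\<close> points
  is \<open>1\<close> for the uniform and \<open>(1 - \<alpha>) N / (N - 1)\<close> for the lazy measure.\<close>

section \<open>Chains of prescribed length\<close>

definition chain_of_length :: "('a \<times> 'a) set \<Rightarrow> 'a \<Rightarrow> 'a \<Rightarrow> nat \<Rightarrow> bool" where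
  "chain_of_length R x y m \<longleftrightarrow>
     (\<exists>z :: nat \<Rightarrow> 'a. z 0 = x \<and> z m = y \<and> (\<forall>i<m. chron R (z i) (z (Suc i))))"

lemma time_sep_eq_Max:
  "(x, y) \<in> R \<Longrightarrow> time_sep R x y = Max {m. chain_of_length R x y m}"
  by (simp add: time_sep_def chain_of_length_def)

lemma chain_of_length_append:
  assumes "chain_of_length R x y k" and "chain_of_length R y w l"
  shows "chain_of_length R x w (k + l)"
proof -
  obtain p q where p: "p 0 = x" "p k = y" "\<And>i. i < k \<Longrightarrow> chron R (p i) (p (Suc i))"
    and q: "q 0 = y" "q l = w" "\<And>i. i < l \<Longrightarrow> chron R (q i) (q (Suc i))"
    using assms by (auto simp: chain_of_length_def)
  define z where "z i = (if i \<le> k then p i else q (i - k))" for i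
  \<comment> \<open>The two pieces overlap in one point: since \<open>p k = q 0\<close>, the step at
    \<open>i = k\<close> is already a step of \<open>q\<close>.\<close>
  have "chron R (z i) (z (Suc i))" if "i < k + l" for i
  proof (cases i k rule: linorder_cases)
    case equal
    then show ?thesis using p(2) q(1) q(3)[of 0] that by (simp add: z_def)
  next
    case greater
    then show ?thesis using q(3)[of "i - k"] that by (simp add: z_def Suc_diff_le)
  qed (use p(3) in \<open>simp add: z_def\<close>)
  moreover have "z 0 = x" "z (k + l) = w"
    using p q by (auto simp: z_def)
  ultimately show ?thesis
    unfolding chain_of_length_def by blast
qed

lemma chain_of_length_segment:
  assumes "\<And>i. i < m \<Longrightarrow> chron R (z i) (z (Suc i))" and "i \<le> j" and "j \<le> m"
  shows "chain_of_length R (z i) (z j) (j - i)"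
  unfolding chain_of_length_def
  by (rule exI[of _ "\<lambda>k. z (i + k)"]) (use assms in auto)

section \<open>Time separation in a causal set\<close>

context
  fixes C :: "'a set" and R :: "('a \<times> 'a) set"
  assumes causal: "causal_set C R"
begin

lemma causal_set_order:
  shows causal_subset: "R \<subseteq> C \<times> C"
    and causal_refl: "x \<in> C \<Longrightarrow> (x, x) \<in> R"
    and causal_trans: "(x, y) \<in> R \<Longrightarrow> (y, z) \<in> R \<Longrightarrow> (x, z) \<in> R"
    and causal_antisym: "(x, y) \<in> R \<Longrightarrow> (y, x) \<in> R \<Longrightarrow> x = y"
  using causal
  unfolding causal_set_def partial_order_on_def preorder_on_def refl_on_def trans_def antisym_def
  by blast+

lemma causal_refl_left: "(x, y) \<in> R \<Longrightarrow> (x, x) \<in> R"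
  and causal_refl_right: "(x, y) \<in> R \<Longrightarrow> (y, y) \<in> R"
  using causal_subset causal_refl by auto

lemma finite_diamond: "(x, z) \<in> R \<Longrightarrow> finite (diamond R x z)"
  using causal causal_subset by (auto simp: causal_set_def)

text \<open>A chain cannot return to an earlier point: if \<open>z (Suc j) = z i\<close>,
  antisymmetry would force \<open>z i = z j\<close>.\<close>

lemma chron_chain_less:
  assumes "\<And>k. k < m \<Longrightarrow> chron R (z k) (z (Suc k))"
  shows "i < j \<Longrightarrow> j \<le> m \<Longrightarrow> chron R (z i) (z j)"
proof (induction j)
  case (Suc j)
  have step: "chron R (z j) (z (Suc j))" using assms Suc.prems by simp
  show ?case
  proof (cases "i = j")
    case False
    then have "chron R (z i) (z j)" using Suc by simp
    with step show ?thesis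
      unfolding chron_def using causal_trans causal_antisym by metis
  qed (use step in simp)
qed simp

text \<open>A chain with \<open>m\<close> steps visits \<open>m + 1\<close> distinct points, all in
  the diamond. Finiteness of diamonds thus bounds the lengths under \<open>Max\<close> in
  \<open>time_sep\<close>.\<close>

lemma chain_of_length_less_card:
  assumes "(x, y) \<in> R" and "chain_of_length R x y m"
  shows "m < card (diamond R x y)"
proof -
  obtain z where z: "z 0 = x" "z m = y" "\<And>i. i < m \<Longrightarrow> chron R (z i) (z (Suc i))"
    using assms(2) by (auto simp: chain_of_length_def)
  have less: "chron R (z i) (z j)" if "i < j" "j \<le> m" for i j
    using chron_chain_less[of m z] z(3) that by blast
  have "inj_on z {..m}"
    by (intro linorder_inj_onI) (use less in \<open>auto simp: chron_def\<close>)
  moreover have "z ` {..m} \<subseteq> diamond R x y"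
  proof (clarsimp simp: diamond_def)
    fix i assume i: "i \<le> m"
    have "(x, z i) \<in> R"
      using less[of 0 i] i z(1) causal_refl_left[OF assms(1)] by (cases "i = 0") (auto simp: chron_def)
    moreover have "(z i, y) \<in> R"
      using less[of i m] i z(2) causal_refl_right[OF assms(1)] by (cases "i = m") (auto simp: chron_def)
    ultimately show "(x, z i) \<in> R \<and> (z i, y) \<in> R" ..
  qed
  ultimately have "card {..m} \<le> card (diamond R x y)"
    using finite_diamond[OF assms(1)] by (metis card_image card_mono)
  then show ?thesis by simp
qed

lemma chain_of_length_imp_causal:
  assumes "chain_of_length R x y m" and "x \<in> C"
  shows "(x, y) \<in> R"
proof -
  obtain z where z: "z 0 = x" "z m = y" "\<And>i. i < m \<Longrightarrow> chron R (z i) (z (Suc i))"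
    using assms(1) by (auto simp: chain_of_length_def)
  show ?thesis
    using chron_chain_less[of m z 0 m] z assms(2) causal_refl by (cases "m = 0") (auto simp: chron_def)
qed

lemma finite_chain_lengths:
  "(x, y) \<in> R \<Longrightarrow> finite {m. chain_of_length R x y m}"
  by (rule finite_subset[of _ "{..card (diamond R x y)}"])
    (auto intro: less_imp_le chain_of_length_less_card)

lemma chain_of_length_le_time_sep:
  "(x, y) \<in> R \<Longrightarrow> chain_of_length R x y m \<Longrightarrow> m \<le> time_sep R x y"
  by (simp add: time_sep_eq_Max finite_chain_lengths)

lemma chain_of_length_one: "chron R x y \<Longrightarrow> chain_of_length R x y 1"
  unfolding chain_of_length_def by (rule exI[of _ "\<lambda>i. if i = 0 then x else y"]) simp

lemma chain_of_length_time_sep: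
  assumes "(x, y) \<in> R"
  shows "chain_of_length R x y (time_sep R x y)"
proof -
  \<comment> \<open>\<open>Max\<close> is attained only on a nonempty set: the witness is the
    trivial chain if \<open>x = y\<close> and a single step otherwise.\<close>
  have "\<exists>m. chain_of_length R x y m"
  proof (cases "x = y")
    case True
    then have "chain_of_length R x y 0" by (auto simp: chain_of_length_def)
    then show ?thesis ..
  next
    case False
    then show ?thesis using assms chain_of_length_one by (auto simp: chron_def)
  qed
  then have "Max {m. chain_of_length R x y m} \<in> {m. chain_of_length R x y m}"
    by (intro Max_in finite_chain_lengths assms) auto
  then show ?thesis by (simp add: time_sep_eq_Max assms)
qed

text \<open>Two longest chains concatenate to a chain from \<open>x\<close> to \<open>z\<close>, and
  the maximum is at least its length.\<close>

lemma reverse_triangle: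
  assumes "(x, y) \<in> R" and "(y, z) \<in> R"
  shows "time_sep R x y + time_sep R y z \<le> time_sep R x z"
  using chain_of_length_append[OF chain_of_length_time_sep chain_of_length_time_sep] assms
  by (blast intro: chain_of_length_le_time_sep causal_trans)

lemma time_sep_self: "x \<in> C \<Longrightarrow> time_sep R x x = 0"
  using reverse_triangle[of x x x] causal_refl by simp

lemma time_sep_pos: "chron R x y \<Longrightarrow> 1 \<le> time_sep R x y"
  by (rule chain_of_length_le_time_sep[OF _ chain_of_length_one]) (auto simp: chron_def)

section \<open>Maximising geodesics\<close>

lemma max_geodesic_causal:
  assumes "max_geodesic C R m \<gamma>" and "i \<le> j" and "j \<le> m"
  shows "(\<gamma> i, \<gamma> j) \<in> R"
  using assms
  by (intro chain_of_length_imp_causal[OF chain_of_length_segment[of m]]) (auto simp: max_geodesic_def)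

text \<open>Cut the geodesic at \<open>i\<close> and \<open>j\<close>. Each of the three separations
  is at least the number of steps of its segment, and by the reverse triangle inequality they sum to
  at most \<open>m\<close>, so none can be larger.\<close>

lemma max_geodesic_time_sep:
  assumes geo: "max_geodesic C R m \<gamma>" and ij: "i \<le> j" "j \<le> m"
  shows "time_sep R (\<gamma> i) (\<gamma> j) = j - i"
proof -
  note R = max_geodesic_causal[OF geo]
  have ge: "l - k \<le> time_sep R (\<gamma> k) (\<gamma> l)" if "k \<le> l" "l \<le> m" for k l
    using geo that
    by (intro chain_of_length_le_time_sep R chain_of_length_segment[of m]) (auto simp: max_geodesic_def)
  have "time_sep R (\<gamma> 0) (\<gamma> i) + time_sep R (\<gamma> i) (\<gamma> j) \<le> time_sep R (\<gamma> 0) (\<gamma> j)"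
    using ij by (intro reverse_triangle R) auto
  moreover have "time_sep R (\<gamma> 0) (\<gamma> j) + time_sep R (\<gamma> j) (\<gamma> m) \<le> time_sep R (\<gamma> 0) (\<gamma> m)"
    using ij by (intro reverse_triangle R) auto
  moreover have "time_sep R (\<gamma> 0) (\<gamma> m) = m"
    using geo by (simp add: max_geodesic_def)
  ultimately show ?thesis
    using ge[of 0 i] ge[OF ij] ge[of j m] ij by linarith
qed

section \<open>Diamonds of height two\<close>

text \<open>The reverse triangle inequality leaves at most 2 to be shared between both sides of
  \<open>w\<close>, and an inner point takes at least 1 on each side.\<close>

lemma height_two_level:
  assumes "(u, v) \<in> R" and "time_sep R u v = 2" and "w \<in> diamond R u v"
  shows "time_sep R u w = (if w = u then 0 else if w = v then 2 else 1)"
    and "time_sep R u w + time_sep R w v = 2"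
proof -
  have R: "(u, w) \<in> R" "(w, v) \<in> R" using assms(3) by (auto simp: diamond_def)
  have C: "u \<in> C" "v \<in> C" using assms(1) causal_subset by auto
  have le: "time_sep R u w + time_sep R w v \<le> 2"
    using reverse_triangle[OF R] assms(2) by simp
  have mid: "1 \<le> time_sep R u w \<and> 1 \<le> time_sep R w v" if "w \<noteq> u" "w \<noteq> v"
    using that R time_sep_pos[of u w] time_sep_pos[of w v] by (simp add: chron_def)
  show "time_sep R u w = (if w = u then 0 else if w = v then 2 else 1)"
    using le mid C assms(2) by (auto simp: time_sep_self)
  show "time_sep R u w + time_sep R w v = 2"
    using le mid C assms(2) by (cases "w = u"; cases "w = v") (auto simp: time_sep_self)
qed

lemma height_two_endpoints:
  assumes "(u, v) \<in> R" and "time_sep R u v = 2"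
  shows "finite (diamond R u v)" and "u \<in> diamond R u v" and "v \<in> diamond R u v" and "u \<noteq> v"
    and "2 \<le> card (diamond R u v)"
proof -
  show fin: "finite (diamond R u v)" by (rule finite_diamond[OF assms(1)])
  show u: "u \<in> diamond R u v" and v: "v \<in> diamond R u v"
    using assms(1) causal_refl_left causal_refl_right by (auto simp: diamond_def)
  show ne: "u \<noteq> v"
    using assms time_sep_self causal_subset by auto
  have "card {u, v} \<le> card (diamond R u v)"
    using fin u v by (intro card_mono) auto
  with ne show "2 \<le> card (diamond R u v)" by simp
qed

text \<open>The top counts 2 and the \<open>card - 2\<close> inner points count 1 each. The bottom
  is left out because the lazy measure weights it separately.\<close>

lemma sum_level:
  assumes "(u, v) \<in> R" and "time_sep R u v = 2"
  shows "(\<Sum>w\<in>diamond R u v - {u}. real (time_sep R u w)) = real (card (diamond R u v))"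
proof -
  let ?J = "diamond R u v"
  note J = height_two_endpoints[OF assms]
  have "(\<Sum>w\<in>?J - {u}. real (time_sep R u w)) =
      real (time_sep R u v) + (\<Sum>w\<in>?J - {u} - {v}. real (time_sep R u w))"
    using J by (intro sum.remove) auto
  also have "(\<Sum>w\<in>?J - {u} - {v}. real (time_sep R u w)) = (\<Sum>w\<in>?J - {u} - {v}. 1)"
    by (intro sum.cong) (auto simp: height_two_level[OF assms])
  also have "\<dots> = real (card ?J) - 2"
    using J by (simp add: of_nat_diff)
  finally show ?thesis using assms(2) by simp
qed

section \<open>Mean levels of the uniform and the lazy measure\<close>

lemma expectation_level_unif:
  assumes "(u, v) \<in> R" and "time_sep R u v = 2"
  shows "measure_pmf.expectation (unif_diamond R u v) (\<lambda>w. real (time_sep R u w)) = 1"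
proof -
  let ?J = "diamond R u v"
  note J = height_two_endpoints[OF assms]
  have "(\<Sum>w\<in>?J. real (time_sep R u w)) =
      real (time_sep R u u) + (\<Sum>w\<in>?J - {u}. real (time_sep R u w))"
    using J by (intro sum.remove) auto
  also have "\<dots> = real (card ?J)"
    using sum_level[OF assms] height_two_level(1)[OF assms J(2)] by simp
  finally have "(\<Sum>w\<in>?J. real (time_sep R u w)) = real (card ?J)" .
  moreover have "?J \<noteq> {}" using J(2) by blast
  ultimately show ?thesis
    using J(1,5) by (simp add: unif_diamond_def integral_pmf_of_set)
qed

lemma set_pmf_lazy_subset:
  assumes "chron R u v" and "0 \<le> \<alpha>" "\<alpha> \<le> 1"
  shows "set_pmf (lazy_diamond R \<alpha> u v) \<subseteq> diamond R u v"
proof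
  fix w assume "w \<in> set_pmf (lazy_diamond R \<alpha> u v)"
  then have "pmf (lazy_diamond R \<alpha> u v) w \<noteq> 0" by (simp add: set_pmf_iff)
  moreover have "u \<in> diamond R u v"
    using assms(1) causal_refl_left by (auto simp: diamond_def chron_def)
  moreover have "(\<Sum>z\<in>diamond R u v - {u}. indicator {z} w :: real) = 0" if "w \<notin> diamond R u v"
    using that by (intro sum.neutral) (auto simp: indicator_def)
  ultimately show "w \<in> diamond R u v"
    by (cases "w = u") (auto simp: pmf_lazy_diamond[OF causal assms])
qed

text \<open>The atom of mass \<open>\<alpha>\<close> sits at level 0, so only the common weight of
  the other points counts. Writing N / (N - 1) as 1 + 1 / (N - 1) lets the constant cancel between
  the two diamonds.\<close>

lemma expectation_level_lazy:
  assumes "(u, v) \<in> R" and "time_sep R u v = 2" and \<alpha>: "0 \<le> \<alpha>" "\<alpha> \<le> 1"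
  shows "measure_pmf.expectation (lazy_diamond R \<alpha> u v) (\<lambda>w. real (time_sep R u w)) =
    (1 - \<alpha>) * (1 + 1 / (real (card (diamond R u v)) - 1))"
proof -
  let ?J = "diamond R u v" and ?p = "lazy_diamond R \<alpha> u v"
  define c where "c = (1 - \<alpha>) / (real (card ?J) - 1)"
  note J = height_two_endpoints[OF assms(1,2)]
  have ch: "chron R u v" using assms(1) J(4) by (simp add: chron_def)
  have pmf: "pmf ?p w = c" if "w \<in> ?J - {u}" for w
    using that J(1) by (simp add: pmf_lazy_diamond[OF causal ch \<alpha>] c_def indicator_def)
  have "measure_pmf.expectation ?p (\<lambda>w. real (time_sep R u w)) =
      (\<Sum>w\<in>?J. real (time_sep R u w) * pmf ?p w)"
    using set_pmf_lazy_subset[OF ch \<alpha>] J(1) by (intro integral_measure_pmf_real) auto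
  also have "\<dots> = real (time_sep R u u) * pmf ?p u + (\<Sum>w\<in>?J - {u}. real (time_sep R u w) * pmf ?p w)"
    using J by (intro sum.remove) auto
  also have "(\<Sum>w\<in>?J - {u}. real (time_sep R u w) * pmf ?p w) = (\<Sum>w\<in>?J - {u}. real (time_sep R u w)) * c"
    by (simp add: pmf sum_distrib_right)
  also have "real (time_sep R u u) * pmf ?p u + \<dots> = real (card ?J) * c"
    using height_two_level(1)[OF assms(1,2) J(2)] sum_level[OF assms(1,2)] by simp
  also have "\<dots> = (1 - \<alpha>) * (1 + 1 / (real (card ?J) - 1))"
    using J(5) by (simp add: c_def field_simps)
  finally show ?thesis .
qed

end

section \<open>Transport with a separable cost\<close>

text \<open>The expectation of a separable cost depends only on the marginals, so all causal
  couplings have the same value and no optimisation remains.\<close>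

lemma ell_1_separable:
  assumes fin: "finite (set_pmf \<mu>)" "finite (set_pmf \<nu>)"
    and R: "\<And>a b. a \<in> set_pmf \<mu> \<Longrightarrow> b \<in> set_pmf \<nu> \<Longrightarrow> (a, b) \<in> R"
    and sep: "\<And>a b. a \<in> set_pmf \<mu> \<Longrightarrow> b \<in> set_pmf \<nu> \<Longrightarrow> real (time_sep R a b) = g b - f a"
  shows "ell_1 R \<mu> \<nu> = ereal (measure_pmf.expectation \<nu> g - measure_pmf.expectation \<mu> f)"
proof -
  let ?v = "measure_pmf.expectation \<nu> g - measure_pmf.expectation \<mu> f"
  have val: "transport_value R \<pi> = ?v" if "\<pi> \<in> causal_couplings R \<mu> \<nu>" for \<pi>
  proof -
    have m: "map_pmf fst \<pi> = \<mu>" "map_pmf snd \<pi> = \<nu>"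
      using that by (auto simp: causal_couplings_def)
    have sub: "set_pmf \<pi> \<subseteq> set_pmf \<mu> \<times> set_pmf \<nu>"
      unfolding m[symmetric] by force
    then have fin\<pi>: "finite (set_pmf \<pi>)"
      using fin by (meson finite_SigmaI finite_subset)
    have "transport_value R \<pi> = (\<Sum>p\<in>set_pmf \<pi>. (g (snd p) - f (fst p)) * pmf \<pi> p)"
      unfolding transport_value_def using sub sep
      by (intro sum.cong) (auto simp: mult.commute)
    also have "\<dots> = measure_pmf.expectation \<pi> (\<lambda>p. g (snd p) - f (fst p))"
      using fin\<pi> by (intro integral_measure_pmf_real[symmetric]) auto
    also have "\<dots> = measure_pmf.expectation \<pi> (\<lambda>p. g (snd p)) - measure_pmf.expectation \<pi> (\<lambda>p. f (fst p))"
      by (intro Bochner_Integration.integral_diff integrable_measure_pmf_finite fin\<pi>)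
    also have "\<dots> = ?v"
      unfolding m[symmetric] by simp
    finally show ?thesis .
  qed
  \<comment> \<open>The product coupling excludes the value \<open>-\<infinity>\<close>: a pair
    outside \<open>R\<close> has a component outside its support, hence mass 0.\<close>
  have "pair_pmf \<mu> \<nu> \<in> causal_couplings R \<mu> \<nu>"
    using R by (auto simp: causal_couplings_def map_fst_pair_pmf map_snd_pair_pmf pmf_pair set_pmf_iff)
  then have "transport_value R ` causal_couplings R \<mu> \<nu> = {?v}"
    and "causal_couplings R \<mu> \<nu> \<noteq> {}"
    using val by (auto simp: image_iff)
  moreover have "(GREATEST v. v \<in> {?v}) = ?v"
    by (rule Greatest_equality) auto
  ultimately show ?thesis
    unfolding ell_1_def by simp
qed

section \<open>Transport between the two diamonds of a geodesic\<close>

lemma geodesic_diamonds_time_sep: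
  assumes causal: "causal_set C R" and n: "2 \<le> n" and geo: "max_geodesic C R (n + 2) \<gamma>"
    and a: "a \<in> diamond R (\<gamma> 0) (\<gamma> 2)" and b: "b \<in> diamond R (\<gamma> n) (\<gamma> (n + 2))"
  shows "(a, b) \<in> R"
    and "time_sep R a b + time_sep R (\<gamma> 0) a = n + time_sep R (\<gamma> n) b"
proof -
  note trans = causal_trans[OF causal] and tri = reverse_triangle[OF causal]
  note \<gamma> = max_geodesic_causal[OF causal geo] and \<tau> = max_geodesic_time_sep[OF causal geo]
  have aR: "(\<gamma> 0, a) \<in> R" "(a, \<gamma> 2) \<in> R" and bR: "(\<gamma> n, b) \<in> R" "(b, \<gamma> (n + 2)) \<in> R"
    using a b by (auto simp: diamond_def)
  have mid: "(\<gamma> 2, \<gamma> n) \<in> R" using n by (intro \<gamma>) auto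
  show ab: "(a, b) \<in> R" using trans aR(2) mid bR(1) by blast
  have la: "time_sep R (\<gamma> 0) a + time_sep R a (\<gamma> 2) = 2"
    using n a by (intro height_two_level[OF causal] \<gamma>) (auto simp: \<tau>)
  have lb: "time_sep R (\<gamma> n) b + time_sep R b (\<gamma> (n + 2)) = 2"
    using n b by (intro height_two_level[OF causal] \<gamma>) (auto simp: \<tau>)
  \<comment> \<open>Lower bound for \<open>time_sep R a b\<close> along the route \<open>a\<close>,
    \<open>\<gamma> 2\<close>, \<open>\<gamma> n\<close>, \<open>b\<close>; \<open>2 \<le> n\<close>
    puts \<open>\<gamma> 2\<close> before \<open>\<gamma> n\<close>.\<close>
  have "time_sep R a (\<gamma> 2) + time_sep R (\<gamma> 2) (\<gamma> n) \<le> time_sep R a (\<gamma> n)"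
    by (rule tri[OF aR(2) mid])
  moreover have "time_sep R a (\<gamma> n) + time_sep R (\<gamma> n) b \<le> time_sep R a b"
    by (rule tri[OF trans[OF aR(2) mid] bR(1)])
  \<comment> \<open>Upper bound: the route \<open>\<gamma> 0\<close>, \<open>a\<close>,
    \<open>b\<close>, \<open>\<gamma> (n + 2)\<close> has total at most \<open>n + 2\<close>. By
    \<open>la\<close> and \<open>lb\<close> it coincides with the lower bound.\<close>
  moreover have "time_sep R (\<gamma> 0) a + time_sep R a b \<le> time_sep R (\<gamma> 0) b"
    by (rule tri[OF aR(1) ab])
  moreover have "time_sep R (\<gamma> 0) b + time_sep R b (\<gamma> (n + 2)) \<le> time_sep R (\<gamma> 0) (\<gamma> (n + 2))"
    by (rule tri[OF trans[OF aR(1) ab] bR(2)])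
  moreover have "time_sep R (\<gamma> 2) (\<gamma> n) = n - 2" "time_sep R (\<gamma> 0) (\<gamma> (n + 2)) = n + 2"
    using n by (simp_all add: \<tau>)
  ultimately show "time_sep R a b + time_sep R (\<gamma> 0) a = n + time_sep R (\<gamma> n) b"
    using la lb n by linarith
qed

text \<open>Only the supports matter, so the uniform and the lazy measures are treated at
  once.\<close>

lemma ell_1_geodesic_diamonds:
  assumes causal: "causal_set C R" and n: "2 \<le> n" and geo: "max_geodesic C R (n + 2) \<gamma>"
    and \<mu>: "set_pmf \<mu> \<subseteq> diamond R (\<gamma> 0) (\<gamma> 2)"
    and \<nu>: "set_pmf \<nu> \<subseteq> diamond R (\<gamma> n) (\<gamma> (n + 2))"
  shows "ell_1 R \<mu> \<nu> = ereal (real n + measure_pmf.expectation \<nu> (\<lambda>b. real (time_sep R (\<gamma> n) b))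
    - measure_pmf.expectation \<mu> (\<lambda>a. real (time_sep R (\<gamma> 0) a)))"
proof -
  let ?f = "\<lambda>a. real (time_sep R (\<gamma> 0) a)" and ?g = "\<lambda>b. real (time_sep R (\<gamma> n) b)"
  note ts = geodesic_diamonds_time_sep[OF causal n geo]
  have fin: "finite (set_pmf \<mu>)" "finite (set_pmf \<nu>)"
    using n by (auto intro!: finite_subset[OF \<mu>] finite_subset[OF \<nu>] finite_diamond[OF causal]
        max_geodesic_causal[OF causal geo])
  have "ell_1 R \<mu> \<nu> =
      ereal (measure_pmf.expectation \<nu> (\<lambda>b. real n + ?g b) - measure_pmf.expectation \<mu> ?f)"
  proof (rule ell_1_separable[OF fin])
    fix a b assume "a \<in> set_pmf \<mu>" "b \<in> set_pmf \<nu>"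
    then have ab: "a \<in> diamond R (\<gamma> 0) (\<gamma> 2)" "b \<in> diamond R (\<gamma> n) (\<gamma> (n + 2))"
      using \<mu> \<nu> by auto
    show "(a, b) \<in> R" by (rule ts(1)[OF ab])
    show "real (time_sep R a b) = real n + ?g b - ?f a" using ts(2)[OF ab] by linarith
  qed
  also have "measure_pmf.expectation \<nu> (\<lambda>b. real n + ?g b) = real n + measure_pmf.expectation \<nu> ?g"
    by (subst Bochner_Integration.integral_add) (auto intro: integrable_measure_pmf_finite fin)
  finally show ?thesis .
qed

section \<open>The curvatures of the geodesic\<close>

theorem proposition3p6:
  fixes C :: "'a set" and R :: "('a \<times> 'a) set" and n :: nat and \<gamma> :: "nat \<Rightarrow> 'a" and \<alpha> :: real
  assumes "causal_set C R"
    and "n \<ge> 2"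
    and "max_geodesic C R (n + 2) \<gamma>"
    and "0 \<le> \<alpha>" and "\<alpha> \<le> 1"
  shows "kappa R 2 n \<gamma> = 0
    \<and> ((\<lambda>\<beta>. kappa_alpha R 2 \<beta> n \<gamma> / ereal (1 - \<beta>)) \<longlongrightarrow> kappa_LLY R 2 n \<gamma>) (at_left 1)
    \<and> kappa_alpha R 2 \<alpha> n \<gamma> = ereal (1 - \<alpha>) * kappa_LLY R 2 n \<gamma>
    \<and> ereal (1 - \<alpha>) * kappa_LLY R 2 n \<gamma> =
        ereal ((1 - \<alpha>) / real n *
          (1 / (real (card (diamond R (\<gamma> n) (\<gamma> (n + 2)))) - 1)
           - 1 / (real (card (diamond R (\<gamma> 0) (\<gamma> 2))) - 1)))"
proof -
  note causal = assms(1) and n = assms(2) and geo = assms(3)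
  define N\<^sub>x N\<^sub>y where "N\<^sub>x = real (card (diamond R (\<gamma> 0) (\<gamma> 2)))"
    and "N\<^sub>y = real (card (diamond R (\<gamma> n) (\<gamma> (n + 2))))"
  \<comment> \<open>\<open>K\<close> is the value that \<open>kappa_LLY\<close> will turn out to
    have.\<close>
  define K where "K = (1 / (N\<^sub>y - 1) - 1 / (N\<^sub>x - 1)) / real n"
  have x: "(\<gamma> 0, \<gamma> 2) \<in> R" "time_sep R (\<gamma> 0) (\<gamma> 2) = 2"
    and y: "(\<gamma> n, \<gamma> (n + 2)) \<in> R" "time_sep R (\<gamma> n) (\<gamma> (n + 2)) = 2"
    and xy: "time_sep R (\<gamma> 0) (\<gamma> n) = n"
    using max_geodesic_causal[OF causal geo] max_geodesic_time_sep[OF causal geo] n by auto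
  note Jx = height_two_endpoints[OF causal x] and Jy = height_two_endpoints[OF causal y]
  have chr: "chron R (\<gamma> 0) (\<gamma> 2)" "chron R (\<gamma> n) (\<gamma> (n + 2))"
    using x y Jx(4) Jy(4) by (auto simp: chron_def)
  note ell = ell_1_geodesic_diamonds[OF causal n geo]
  have "set_pmf (unif_diamond R (\<gamma> 0) (\<gamma> 2)) \<subseteq> diamond R (\<gamma> 0) (\<gamma> 2)"
    "set_pmf (unif_diamond R (\<gamma> n) (\<gamma> (n + 2))) \<subseteq> diamond R (\<gamma> n) (\<gamma> (n + 2))"
    unfolding unif_diamond_def using Jx(1,2) Jy(1,2) by (subst set_pmf_of_set; blast)+
  from ell[OF this]
  \<comment> \<open>Both mean levels are 1 and cancel, whatever the sizes of the diamonds.\<close>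
  have "ell_1 R (unif_diamond R (\<gamma> 0) (\<gamma> 2)) (unif_diamond R (\<gamma> n) (\<gamma> (n + 2))) = ereal (real n)"
    by (simp only: expectation_level_unif[OF causal x] expectation_level_unif[OF causal y]) simp
  then have kappa: "kappa R 2 n \<gamma> = 0"
    using n by (simp add: kappa_def xy one_ereal_def)
  have kappa_alpha: "kappa_alpha R 2 \<beta> n \<gamma> = ereal ((1 - \<beta>) * K)" if \<beta>: "0 \<le> \<beta>" "\<beta> \<le> 1" for \<beta>
  proof -
    have "ell_1 R (lazy_diamond R \<beta> (\<gamma> 0) (\<gamma> 2)) (lazy_diamond R \<beta> (\<gamma> n) (\<gamma> (n + 2))) =
        ereal (real n + (1 - \<beta>) * (1 + 1 / (N\<^sub>y - 1)) - (1 - \<beta>) * (1 + 1 / (N\<^sub>x - 1)))"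
      unfolding ell[OF set_pmf_lazy_subset[OF causal chr(1) \<beta>] set_pmf_lazy_subset[OF causal chr(2) \<beta>]]
        expectation_level_lazy[OF causal x \<beta>] expectation_level_lazy[OF causal y \<beta>]
        N\<^sub>x_def N\<^sub>y_def ..
    \<comment> \<open>The factor \<open>real n\<close> is the separation of
      \<open>\<gamma> 0\<close> and \<open>\<gamma> n\<close>; dividing by it and subtracting 1
      leaves \<open>(1 - \<beta>) * K\<close>.\<close>
    also have "\<dots> = ereal (real n * (1 + (1 - \<beta>) * K))"
    proof -
      have "real n * K = 1 / (N\<^sub>y - 1) - 1 / (N\<^sub>x - 1)" using n by (simp add: K_def)
      then show ?thesis by (simp add: distrib_left right_diff_distrib mult.left_commute[of "real n"])
    qed
    finally show ?thesis
      using n by (simp add: kappa_alpha_def xy one_ereal_def del: add_2_eq_Suc')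
  qed
  \<comment> \<open>On this interval the formula for \<open>kappa_alpha\<close> applies and
    \<open>1 - \<beta>\<close> is nonzero, so the quotient is constantly \<open>K\<close>.\<close>
  have "eventually (\<lambda>\<beta>. \<beta> \<in> {0<..<1 :: real}) (at_left 1)"
    by (rule eventually_at_left_real) simp
  then have "eventually (\<lambda>\<beta>. kappa_alpha R 2 \<beta> n \<gamma> / ereal (1 - \<beta>) = ereal K) (at_left 1)"
    by eventually_elim (simp add: kappa_alpha)
  then have lim: "((\<lambda>\<beta>. kappa_alpha R 2 \<beta> n \<gamma> / ereal (1 - \<beta>)) \<longlongrightarrow> ereal K) (at_left 1)"
    by (rule tendsto_eventually)
  then have LLY: "kappa_LLY R 2 n \<gamma> = ereal K"
    unfolding kappa_LLY_def by (intro tendsto_Lim) simp_all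
  show ?thesis
    using kappa lim kappa_alpha[OF assms(4,5)]
    by (simp add: LLY K_def N\<^sub>x_def N\<^sub>y_def)
qed

end
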